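(* Let $n,k,t$ be positive integers with $n\ge k>t$ and let $A\subseteq[0,1]^n$ be an $(n,k,t)$-set. Then \[\mathcal{H}^{k-t}(A)\le\binom{n-t}{k-t}\sigma_{k-t},\qquad\text{where } \sigma_{d}=\frac{2^{d}\Gamma(d/2+1)}{\pi^{d/2}}.\]
   Context: For positive integers $n\ge k>t$, a subset $A$ of $[0,1]^n$ is an $(n,k,t)$-set if every $(x_1,\ldots,x_n)\in A$ has exactly $k$ strictly positive coordinates, and for every two elements $(x_1,\ldots,x_n),(y_1,\ldots,y_n)\in A$ there exist $t$ distinct indices $i_1,\ldots,i_t$ with $x_{i_j}=y_{i_j}>0$ for all $j\in\{1,\ldots,t\}$. For $S\subseteq\mathbb{R}^n$ and $s>0$, $\mathcal{H}^s(S)=\lim_{\delta\to0}\inf\{\sum_i \operatorname{diam}(U_i)^s : S\subseteq\bigcup_i U_i,\ \operatorname{diam}(U_i)\le\delta\}$ is the unnormalized $s$-dimensional Hausdorff measure; $\sigma_d$ is the $d$-dimensional Hausdorff measure of a unit $d$-cube. *)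

theory Defs
  imports "HOL-Analysis.Analysis"
begin

text \<open>
  Countable covers are sequences of sets, finite covers being padded with empty sets, which
  contribute 0 for \<open>s > 0\<close>. The library's real-valued \<^const>\<open>diameter\<close> is meaningful only on bounded
  sets; a set of diameter at most \<open>\<delta>\<close> is bounded, so boundedness is part of that condition.
\<close>

definition hausdorff_pre :: "real \<Rightarrow> real \<Rightarrow> 'a::metric_space set \<Rightarrow> ennreal" where
  "hausdorff_pre s \<delta> S =
     Inf {(\<Sum>i. ennreal (diameter (U i) powr s)) |U :: nat \<Rightarrow> 'a set.
            S \<subseteq> (\<Union>i. U i) \<and> (\<forall>i. bounded (U i) \<and> diameter (U i) \<le> \<delta>)}"

text \<open>Unnormalized: no factor depending on \<open>s\<close>. Intended for \<open>s > 0\<close> (note \<open>0 powr 0 = 0\<close>).\<close>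

definition hausdorff_measure :: "real \<Rightarrow> 'a::metric_space set \<Rightarrow> ennreal" where
  "hausdorff_measure s S = Lim (at_right 0) (\<lambda>\<delta>. hausdorff_pre s \<delta> S)"

lemma hausdorff_pre_antimono:
  assumes "\<delta> \<le> \<epsilon>"
  shows "hausdorff_pre s \<epsilon> S \<le> hausdorff_pre s \<delta> S"
  unfolding hausdorff_pre_def
  by (rule Inf_superset_mono) (use assms in \<open>blast intro: order_trans\<close>)

lemma hausdorff_pre_tendsto_SUP:
  "((\<lambda>\<delta>. hausdorff_pre s \<delta> S) \<longlongrightarrow> (SUP \<delta>\<in>{0<..}. hausdorff_pre s \<delta> S)) (at_right 0)"
proof (rule order_tendstoI)
  fix a assume "a < (SUP \<delta>\<in>{0<..}. hausdorff_pre s \<delta> S)"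
  then obtain e where e: "e > 0" "a < hausdorff_pre s e S"
    by (auto simp: less_SUP_iff)
  show "eventually (\<lambda>\<delta>. a < hausdorff_pre s \<delta> S) (at_right 0)"
    unfolding eventually_at_right_field
    using e by (intro exI[of _ e]) (auto intro: less_le_trans[OF _ hausdorff_pre_antimono])
next
  fix a assume a: "(SUP \<delta>\<in>{0<..}. hausdorff_pre s \<delta> S) < a"
  show "eventually (\<lambda>\<delta>. hausdorff_pre s \<delta> S < a) (at_right 0)"
    unfolding eventually_at_right_field
    by (intro exI[of _ 1]) (auto intro!: le_less_trans[OF SUP_upper a])
qed

lemma hausdorff_measure_eq_SUP:
  "hausdorff_measure s S = (SUP \<delta>\<in>{0<..}. hausdorff_pre s \<delta> S)"
  unfolding hausdorff_measure_def
  by (rule tendsto_Lim[OF _ hausdorff_pre_tendsto_SUP]) simp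

text \<open>An \<open>(n,k,t)\<close>-set, with \<open>n = CARD('n)\<close>.\<close>

definition nkt_set :: "nat \<Rightarrow> nat \<Rightarrow> (real ^ 'n) set \<Rightarrow> bool" where
  "nkt_set k t A \<longleftrightarrow>
     A \<subseteq> {x. \<forall>i. 0 \<le> x $ i \<and> x $ i \<le> 1} \<and>
     (\<forall>x\<in>A. card {i. x $ i > 0} = k) \<and>
     (\<forall>x\<in>A. \<forall>y\<in>A. \<exists>I. card I = t \<and> (\<forall>i\<in>I. x $ i = y $ i \<and> y $ i > 0))"

text \<open>The \<open>d\<close>-dimensional (unnormalized) Hausdorff measure of a unit \<open>d\<close>-cube, in closed form.\<close>

definition sigma_cube :: "nat \<Rightarrow> real" where
  "sigma_cube d = 2 ^ d * Gamma (real d / 2 + 1) / pi powr (real d / 2)"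

end

theory Submission
  imports Defs
begin

text \<open>
  Any two points of \<open>A\<close> agree on a \<open>t\<close>-set of positive coordinates. Fix \<open>p \<in> A\<close>. If one \<open>t\<close>-set \<open>I\<close>
  serves all of \<open>A\<close>, then \<open>A\<close> lies in the union of the \<open>(n - t) choose (k - t)\<close> unit cubes obtained by
  freezing \<open>I\<close> and choosing \<open>k - t\<close> free coordinates. Otherwise every \<open>t\<close>-set \<open>I\<close> has a witness
  \<open>z I \<in> A\<close> not agreeing with \<open>p\<close> on \<open>I\<close>; a point of \<open>A\<close> agreeing with \<open>p\<close> on \<open>I\<close> agrees with \<open>z I\<close> at
  some further coordinate outside \<open>I\<close>, so \<open>A\<close> is covered by finitely many cubes of dimension less
  than \<open>k - t\<close> and is null.

  That a \<open>d\<close>-dimensional unit cube has measure at most \<open>sigma_cube d\<close> follows from Vitali's covering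
  theorem: \<open>sigma_cube d\<close> is the ratio of \<open>diam\<^sup>d\<close> to volume for \<open>d\<close>-balls. As \<open>d\<close> is not the
  dimension of a type, the covering theorem is applied in the ambient space, and the covering by
  \<open>n\<close>-balls is sliced by \<open>d\<close>-dimensional coordinate planes; averaging over the planes yields a good slice.
\<close>

section \<open>Covering boxes by small balls\<close>

text \<open>Outer regularity puts \<open>N\<close> inside an open \<open>W\<close> of tiny measure.
  Vitali's covering lemma selects disjoint balls inside \<open>W\<close> whose 5-fold enlargements
  cover \<open>N\<close>, and disjointness bounds their total volume by that of
  \<open>W\<close>.\<close>

lemma null_cover_by_small_cballs:
  fixes N :: "'a::euclidean_space set"
  assumes "negligible N" "0 < \<delta>" "0 < e"
  obtains C where "countable C" "\<And>c r. (c, r) \<in> C \<Longrightarrow> 0 < r \<and> r \<le> \<delta>"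
    "N \<subseteq> (\<Union>(c, r)\<in>C. cball c r)"
    "(\<integral>\<^sup>+(c, r). emeasure lborel (cball c r) \<partial>count_space C) \<le> ennreal e"
proof -
  \<comment> \<open>Enlarging a ball 5 times multiplies its volume by \<open>5 ^ DIM('a)\<close>;
    for the same reason the radii in \<open>K\<close> are capped at
    \<open>\<delta> / 5\<close>.\<close>
  define e' where "e' = e / 5 ^ DIM('a)"
  have e': "e' > 0" using assms by (simp add: e'_def)
  obtain W where W: "open W" "N \<subseteq> W" "(W - N) \<in> lmeasurable" "emeasure lebesgue (W - N) < ennreal e'"
    using sets_lebesgue_outer_open[OF negligible_imp_sets[OF assms(1)] e'] by metis
  have "emeasure lebesgue W \<le> emeasure lebesgue (W - N) + emeasure lebesgue N"
  proof -
    have "W = (W - N) \<union> N" using W by auto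
    then show ?thesis
      using emeasure_subadditive[of "W - N" lebesgue N] W negligible_imp_sets[OF assms(1)] by (metis fmeasurableD)
  qed
  also have "emeasure lebesgue N = 0"
    using assms(1) negligible_iff_emeasure0 negligible_imp_sets by blast
  finally have W': "emeasure lborel W \<le> ennreal e'"
    using W by (simp add: emeasure_completion less_imp_le)
  define K where "K = {(x::'a, r). 0 < r \<and> r \<le> \<delta> / 5 \<and> cball x r \<subseteq> W}"
  have cov: "N \<subseteq> (\<Union>i\<in>K. cball (fst i) (snd i))"
  proof
    fix x assume "x \<in> N"
    then obtain r where r: "r > 0" "cball x r \<subseteq> W" using W open_contains_cball by blast
    then have "(x, min r (\<delta>/5)) \<in> K" using assms by (auto simp: K_def)
    then show "x \<in> (\<Union>i\<in>K. cball (fst i) (snd i))"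
      using r assms by (intro UN_I[of "(x, min r (\<delta>/5))"]) auto
  qed
  have rK: "0 < snd i \<and> snd i \<le> \<delta> / 5" if "i \<in> K" for i
    using that by (auto simp: K_def)
  obtain C where C: "countable C" "C \<subseteq> K"
      "pairwise (\<lambda>i j. disjnt (cball (fst i) (snd i)) (cball (fst j) (snd j))) C"
      "N \<subseteq> (\<Union>i\<in>C. cball (fst i) (5 * snd i))"
    by (rule Vitali_covering_lemma_cballs[OF cov rK]) (assumption | rule that)+
  have inj: "inj_on (\<lambda>(c, r). (c, 5 * r)) C" by (auto simp: inj_on_def)
  show ?thesis
  proof
    show "countable ((\<lambda>(c, r). (c, 5 * r)) ` C)" using C by simp
    show "0 < r \<and> r \<le> \<delta>" if "(c, r) \<in> (\<lambda>(c, r). (c, 5 * r)) ` C" for c r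
      using that C(2) by (auto simp: K_def)
    show "N \<subseteq> (\<Union>(c, r)\<in>(\<lambda>(c, r). (c, 5 * r)) ` C. cball c r)"
      using C(4) by (auto simp: case_prod_beta)
    have "(\<integral>\<^sup>+(c, r). emeasure lborel (cball c r) \<partial>count_space ((\<lambda>(c, r). (c, 5 * r)) ` C))
      = (\<integral>\<^sup>+(c, r). emeasure lborel (cball c (5 * r)) \<partial>count_space C)"
      by (subst nn_integral_bij_count_space[OF inj_on_imp_bij_betw[OF inj], symmetric])
        (simp add: case_prod_beta')
    also have "\<dots> = (\<integral>\<^sup>+i. ennreal (5 ^ DIM('a)) * emeasure lborel (cball (fst i) (snd i)) \<partial>count_space C)"
      using C(2)
      by (intro nn_integral_cong)
        (auto simp: K_def emeasure_cball power_mult_distrib ennreal_mult' [symmetric] mult_ac)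
    also have "\<dots> = ennreal (5 ^ DIM('a)) * (\<integral>\<^sup>+i. emeasure lborel (cball (fst i) (snd i)) \<partial>count_space C)"
      by (simp add: nn_integral_cmult)
    also have "(\<integral>\<^sup>+i. emeasure lborel (cball (fst i) (snd i)) \<partial>count_space C)
        = emeasure lborel (\<Union>i\<in>C. cball (fst i) (snd i))"
      using C by (intro emeasure_UN_countable[symmetric])
        (auto simp: disjoint_family_on_def pairwise_def disjnt_def)
    also have "\<dots> \<le> emeasure lborel W"
      using C(2) W(1) by (intro emeasure_mono) (fastforce simp: K_def subset_iff)+
    also have "ennreal (5 ^ DIM('a)) * emeasure lborel W \<le> ennreal (5 ^ DIM('a)) * ennreal e'"
      using W' by (intro mult_left_mono) auto
    also have "\<dots> = ennreal e"
      by (simp add: e'_def ennreal_mult'[symmetric])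
    finally show "(\<integral>\<^sup>+(c, r). emeasure lborel (cball c r) \<partial>count_space ((\<lambda>(c, r). (c, 5 * r)) ` C)) \<le> ennreal e"
      by (simp add: mult_left_mono)
  qed
qed

text \<open>By Vitali's covering theorem, disjoint small balls inside the open box cover almost all
  of it, with total volume at most that of the box. The null remainder and the boundary are covered
  at cost \<open>e\<close> by the previous lemma.\<close>

lemma cbox_cover_by_small_cballs:
  fixes a b :: "'a::euclidean_space"
  assumes "0 < \<delta>" "0 < e"
  obtains C where "countable C" "\<And>c r. (c, r) \<in> C \<Longrightarrow> 0 < r \<and> r \<le> \<delta>"
    "cbox a b \<subseteq> (\<Union>(c, r)\<in>C. cball c r)"
    "(\<integral>\<^sup>+(c, r). emeasure lborel (cball c r) \<partial>count_space C) \<le> emeasure lborel (cbox a b) + ennreal e"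
proof -
  define K where "K = {(x::'a, r). 0 < r \<and> r \<le> \<delta> \<and> cball x r \<subseteq> box a b}"
  have cov: "\<exists>i. i \<in> K \<and> x \<in> cball (fst i) (snd i) \<and> snd i < d" if x: "x \<in> box a b" and d: "d > 0" for x d
  proof -
    obtain r where r: "r > 0" "cball x r \<subseteq> box a b" using x open_contains_cball open_box by blast
    show ?thesis
      using r d assms
      by (intro exI[of _ "(x, min (min r (d/2)) \<delta>)"]) (auto simp: K_def)
  qed
  have rK: "0 < snd i" if "i \<in> K" for i
    using that by (auto simp: K_def)
  obtain C where C: "countable C" "C \<subseteq> K"
      "pairwise (\<lambda>i j. disjnt (cball (fst i) (snd i)) (cball (fst j) (snd j))) C"
      "negligible (box a b - (\<Union>i\<in>C. cball (fst i) (snd i)))"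
    by (rule Vitali_covering_theorem_cballs[OF rK cov]) (assumption | rule that)+
  have neg: "negligible ((box a b - (\<Union>i\<in>C. cball (fst i) (snd i))) \<union> (cbox a b - box a b))"
    using C(4) negligible_frontier_interval by (simp add: negligible_Un)
  obtain B where B: "countable B" "\<And>c r. (c, r) \<in> B \<Longrightarrow> 0 < r \<and> r \<le> \<delta>"
    "(box a b - (\<Union>i\<in>C. cball (fst i) (snd i))) \<union> (cbox a b - box a b) \<subseteq> (\<Union>(c, r)\<in>B. cball c r)"
    "(\<integral>\<^sup>+(c, r). emeasure lborel (cball c r) \<partial>count_space B) \<le> ennreal e"
    by (rule null_cover_by_small_cballs[OF neg assms]) (assumption | rule that)+
  show ?thesis
  proof
    show "countable (C \<union> B)" using C B by simp
    show "0 < r \<and> r \<le> \<delta>" if "(c, r) \<in> C \<union> B" for c r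
      using that C(2) B(2) by (auto simp: K_def)
    show "cbox a b \<subseteq> (\<Union>(c, r)\<in>C \<union> B. cball c r)"
      using B(3) by (fastforce simp: case_prod_beta)
    let ?f = "\<lambda>(c, r). emeasure lborel (cball c r :: 'a set)"
    \<comment> \<open>\<open>C\<close> and \<open>B\<close> may overlap, so the integral over the
      union is only bounded by the sum; indicators make this pointwise.\<close>
    have "(\<integral>\<^sup>+i. ?f i \<partial>count_space (C \<union> B)) = (\<integral>\<^sup>+i. ?f i * indicator (C \<union> B) i \<partial>count_space UNIV)"
      by (rule nn_integral_count_space_indicator) simp
    also have "\<dots> \<le> (\<integral>\<^sup>+i. ?f i * indicator C i + ?f i * indicator B i \<partial>count_space UNIV)"
      by (intro nn_integral_mono) (auto simp: indicator_def)
    also have "\<dots> = (\<integral>\<^sup>+i. ?f i \<partial>count_space C) + (\<integral>\<^sup>+i. ?f i \<partial>count_space B)"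
      by (simp add: nn_integral_add nn_integral_count_space_indicator)
    also have "(\<integral>\<^sup>+i. ?f i \<partial>count_space C) = emeasure lborel (\<Union>i\<in>C. cball (fst i) (snd i))"
      unfolding case_prod_beta using C by (intro emeasure_UN_countable[symmetric])
        (auto simp: disjoint_family_on_def pairwise_def disjnt_def)
    also have "\<dots> \<le> emeasure lborel (cbox a b)"
      using C(2) box_subset_cbox[of a b] by (intro emeasure_mono) (auto simp: K_def subset_iff)
    finally show "(\<integral>\<^sup>+i. ?f i \<partial>count_space (C \<union> B)) \<le> emeasure lborel (cbox a b) + ennreal e"
      using B(4) by (meson add_left_mono add_mono order_trans order_refl)
  qed
qed

section \<open>Slices of balls\<close>

lemma sigma_cube_pos: "0 < sigma_cube d"
  by (simp add: sigma_cube_def Gamma_real_pos)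

lemma sigma_cube_mult_unit_ball_vol: "sigma_cube d * unit_ball_vol (real d) = 2 ^ d"
proof -
  have "Gamma (real d / 2 + 1) > 0" by (simp add: Gamma_real_pos)
  then have "Gamma (real d / 2 + 1) \<noteq> 0" by linarith
  then show ?thesis by (simp add: sigma_cube_def unit_ball_vol_def)
qed

text \<open>The plane through \<open>u\<close> in the directions \<open>D\<close> meets the ball in
  a lower-dimensional ball of dimension \<open>card D\<close>; the integrand is its diameter to that
  power, which is \<open>sigma_cube (card D)\<close> times its volume. By Tonelli, integrating the
  slice volumes over the directions outside \<open>D\<close> gives the volume of the whole ball,
  while the directions in \<open>D\<close> only contribute the factor 1. The \<open>max 0\<close>
  deals with planes that miss the ball.\<close>

lemma nn_integral_chord_centered:
  fixes a :: "'a::euclidean_space"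
  assumes D: "D \<subseteq> Basis" "D \<noteq> {}" and r: "0 < r"
  shows "(\<integral>\<^sup>+u. ennreal ((2 * sqrt (max 0 (r\<^sup>2 - (\<Sum>i\<in>Basis - D. (u \<bullet> i)\<^sup>2)))) ^ card D)
              * indicator (cbox a (a + One)) u \<partial>lborel)
         \<le> ennreal (sigma_cube (card D)) * emeasure lborel (cball (0::'a) r)"
proof -
  define E where "E = Basis - D"
  have fin: "finite D" "finite E" "E \<inter> D = {}" "E \<union> D = Basis" "Basis = E \<union> D"
    using D finite_subset[OF D(1)] by (auto simp: E_def)
  have d: "card D > 0" using D fin by (simp add: card_gt_0_iff)
  interpret product_sigma_finite "\<lambda>_::'a. lborel :: real measure"
    by (simp add: product_sigma_finite_def sigma_finite_lborel)
  define H where "H x = ennreal ((2 * sqrt (max 0 (r\<^sup>2 - (\<Sum>i\<in>E. (x i)\<^sup>2)))) ^ card D)" for x :: "'a \<Rightarrow> real"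
  \<comment> \<open>Only the \<open>D\<close>-part of the unit cube is kept. Dropping the
    restriction in the directions \<open>E\<close> is where equality is lost, and it makes the bound
    independent of \<open>a\<close>.\<close>
  define J where "J y = (\<Prod>i\<in>D. indicator {a \<bullet> i .. a \<bullet> i + 1} (y i) :: ennreal)" for y :: "'a \<Rightarrow> real"
  define p where "p f = (\<Sum>b\<in>Basis. f b *\<^sub>R b)" for f :: "'a \<Rightarrow> real"
  have p: "p f \<bullet> i = f i" if "i \<in> Basis" for f i
    using that by (simp add: p_def)
  have [measurable]: "p \<in> Pi\<^sub>M Basis (\<lambda>_. lborel) \<rightarrow>\<^sub>M borel"
    unfolding p_def by measurable
  have comp: "(\<lambda>f. f i) \<in> Pi\<^sub>M I (\<lambda>_. lborel) \<rightarrow>\<^sub>M (borel :: real measure)" if "i \<in> I" for i :: 'a and I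
    using measurable_component_singleton[OF that, of "\<lambda>_. lborel"] by simp
  have HE: "H \<in> borel_measurable (Pi\<^sub>M I (\<lambda>_. lborel))" if "E \<subseteq> I" for I
  proof -
    have [measurable]: "(\<lambda>x. x i) \<in> borel_measurable (Pi\<^sub>M I (\<lambda>_. lborel :: real measure))" if "i \<in> E" for i
      using comp \<open>E \<subseteq> I\<close> that by auto
    show ?thesis unfolding H_def by measurable
  qed
  have JD: "J \<in> borel_measurable (Pi\<^sub>M I (\<lambda>_. lborel))" if "D \<subseteq> I" for I
    unfolding J_def using that
    by (intro borel_measurable_prod_ennreal measurable_compose[OF comp borel_measurable_indicator]) auto
  \<comment> \<open>The inner integral is the volume of a ball of radius \<open>\<rho>\<close> in
    the directions \<open>D\<close>; \<open>sigma_cube_mult_unit_ball_vol\<close> turns it into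
    \<open>(2 * \<rho>) ^ card D\<close>.\<close>
  have slice: "H x \<le> ennreal (sigma_cube (card D)) *
      (\<integral>\<^sup>+y. indicator {..r\<^sup>2} ((\<Sum>i\<in>E. (x i)\<^sup>2) + (\<Sum>i\<in>D. (y i)\<^sup>2)) \<partial>Pi\<^sub>M D (\<lambda>_. lborel))" for x
  proof (cases "(\<Sum>i\<in>E. (x i)\<^sup>2) < r\<^sup>2")
    case True
    define \<rho> where "\<rho> = sqrt (r\<^sup>2 - (\<Sum>i\<in>E. (x i)\<^sup>2))"
    have \<rho>: "\<rho> > 0" using True by (simp add: \<rho>_def)
    have "(\<integral>\<^sup>+y. indicator {..r\<^sup>2} ((\<Sum>i\<in>E. (x i)\<^sup>2) + (\<Sum>i\<in>D. (y i)\<^sup>2)) \<partial>Pi\<^sub>M D (\<lambda>_. lborel)) =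
      (\<integral>\<^sup>+y. indicator ({f. sqrt (\<Sum>i\<in>D. (f i)\<^sup>2) \<le> \<rho>} \<inter> space (Pi\<^sub>M D (\<lambda>_. lborel))) y \<partial>Pi\<^sub>M D (\<lambda>_. lborel))"
      by (intro nn_integral_cong) (auto simp: indicator_def \<rho>_def)
    also have "\<dots> = emeasure (Pi\<^sub>M D (\<lambda>_. lborel)) ({f. sqrt (\<Sum>i\<in>D. (f i)\<^sup>2) \<le> \<rho>} \<inter> space (Pi\<^sub>M D (\<lambda>_. lborel)))"
    proof (rule nn_integral_indicator)
      have "{f \<in> space (Pi\<^sub>M D (\<lambda>_. lborel)). sqrt (\<Sum>i\<in>D. (f i)\<^sup>2) \<le> \<rho>} \<in> sets (Pi\<^sub>M D (\<lambda>_. lborel))"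
        by measurable
      then show "{f. sqrt (\<Sum>i\<in>D. (f i)\<^sup>2) \<le> \<rho>} \<inter> space (Pi\<^sub>M D (\<lambda>_. lborel)) \<in> sets (Pi\<^sub>M D (\<lambda>_. lborel))"
        by (simp add: Int_def conj_commute)
    qed
    also have "\<dots> = ennreal (unit_ball_vol (real (card D)) * \<rho> ^ card D)"
      using fin \<rho> by (simp add: emeasure_cball_aux)
    finally show ?thesis
      using True \<rho> sigma_cube_pos[of "card D"]
      by (simp add: H_def \<rho>_def[symmetric] max_def ennreal_mult'[symmetric] mult.assoc[symmetric]
          sigma_cube_mult_unit_ball_vol power_mult_distrib)
  next
    \<comment> \<open>Here \<open>D \<noteq> {}\<close> matters: \<open>0 ^ card D\<close> has to be
      0, not 1.\<close>
    case False
    then have "H x = 0" using d by (simp add: H_def max_def zero_power)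
    then show ?thesis by simp
  qed
  have "(\<integral>\<^sup>+u. ennreal ((2 * sqrt (max 0 (r\<^sup>2 - (\<Sum>i\<in>E. (u \<bullet> i)\<^sup>2)))) ^ card D)
              * indicator (cbox a (a + One)) u \<partial>lborel)
     = (\<integral>\<^sup>+f. ennreal ((2 * sqrt (max 0 (r\<^sup>2 - (\<Sum>i\<in>E. (p f \<bullet> i)\<^sup>2)))) ^ card D)
              * indicator (cbox a (a + One)) (p f) \<partial>Pi\<^sub>M Basis (\<lambda>_. lborel))"
    by (subst lborel_eq, subst nn_integral_distr) (auto simp: p_def[symmetric])
  also have "\<dots> \<le> (\<integral>\<^sup>+f. H f * J f \<partial>Pi\<^sub>M Basis (\<lambda>_. lborel))"
  proof (intro nn_integral_mono mult_mono)
    fix f :: "'a \<Rightarrow> real"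
    show "ennreal ((2 * sqrt (max 0 (r\<^sup>2 - (\<Sum>i\<in>E. (p f \<bullet> i)\<^sup>2)))) ^ card D) \<le> H f"
      by (simp add: H_def p E_def)
    show "indicator (cbox a (a + One)) (p f) \<le> J f"
    proof (cases "p f \<in> cbox a (a + One)")
      case True
      then have "indicator {a \<bullet> i .. a \<bullet> i + 1} (f i) = (1::ennreal)" if "i \<in> D" for i
        using that D by (auto simp: mem_box p inner_add_left subset_iff)
      then have "J f = 1" by (simp add: J_def)
      then show ?thesis by (auto simp: indicator_def)
    qed simp
  qed auto
  also have "\<dots> = (\<integral>\<^sup>+x. \<integral>\<^sup>+y. H (merge E D (x, y)) * J (merge E D (x, y)) \<partial>Pi\<^sub>M D (\<lambda>_. lborel) \<partial>Pi\<^sub>M E (\<lambda>_. lborel))"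
    using fin(1-3)
    by (subst fin(5), intro product_nn_integral_fold borel_measurable_times_ennreal HE JD) auto
  also have "\<dots> = (\<integral>\<^sup>+x. \<integral>\<^sup>+y. H x * J y \<partial>Pi\<^sub>M D (\<lambda>_. lborel) \<partial>Pi\<^sub>M E (\<lambda>_. lborel))"
  proof (intro nn_integral_cong)
    fix x y
    have "H (merge E D (x, y)) = H x" by (simp add: H_def merge_def)
    moreover have "J (merge E D (x, y)) = J y"
      unfolding J_def using fin(3) by (intro prod.cong) (auto simp: merge_def)
    ultimately show "H (merge E D (x, y)) * J (merge E D (x, y)) = H x * J y" by simp
  qed
  also have "\<dots> = (\<integral>\<^sup>+x. H x \<partial>Pi\<^sub>M E (\<lambda>_. lborel))"
  proof (intro nn_integral_cong)
    fix x
    have "(\<integral>\<^sup>+y. J y \<partial>Pi\<^sub>M D (\<lambda>_. lborel)) = 1"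
      unfolding J_def using fin by (subst product_nn_integral_prod) auto
    then show "(\<integral>\<^sup>+y. H x * J y \<partial>Pi\<^sub>M D (\<lambda>_. lborel)) = H x"
      by (subst nn_integral_cmult) (auto intro!: JD)
  qed
  also have "\<dots> \<le> (\<integral>\<^sup>+x. ennreal (sigma_cube (card D)) * (\<integral>\<^sup>+y. indicator {..r\<^sup>2} ((\<Sum>i\<in>E. (x i)\<^sup>2) + (\<Sum>i\<in>D. (y i)\<^sup>2)) \<partial>Pi\<^sub>M D (\<lambda>_. lborel)) \<partial>Pi\<^sub>M E (\<lambda>_. lborel))"
    by (intro nn_integral_mono slice)
  also have "\<dots> = (\<integral>\<^sup>+x. (\<integral>\<^sup>+y. ennreal (sigma_cube (card D)) * indicator {..r\<^sup>2} ((\<Sum>i\<in>E. (x i)\<^sup>2) + (\<Sum>i\<in>D. (y i)\<^sup>2)) \<partial>Pi\<^sub>M D (\<lambda>_. lborel)) \<partial>Pi\<^sub>M E (\<lambda>_. lborel))"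
    by (intro nn_integral_cong nn_integral_cmult[symmetric]) measurable
  \<comment> \<open>Tonelli is now used in reverse: written in merged coordinates, the region is the
    full ball of radius \<open>r\<close>.\<close>
  also have "\<dots> = (\<integral>\<^sup>+x. (\<integral>\<^sup>+y. ennreal (sigma_cube (card D)) * indicator {..r\<^sup>2} (\<Sum>i\<in>Basis. (merge E D (x, y) i)\<^sup>2) \<partial>Pi\<^sub>M D (\<lambda>_. lborel)) \<partial>Pi\<^sub>M E (\<lambda>_. lborel))"
  proof (intro nn_integral_cong arg_cong2[where f="(*)"] arg_cong[where f="indicator _"] refl)
    fix x y :: "'a \<Rightarrow> real"
    have "(\<Sum>i\<in>Basis. (merge E D (x, y) i)\<^sup>2) = (\<Sum>i\<in>E. (merge E D (x, y) i)\<^sup>2) + (\<Sum>i\<in>D. (merge E D (x, y) i)\<^sup>2)"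
      using fin(1-3) by (subst fin(5), intro sum.union_disjoint)
    also have "\<dots> = (\<Sum>i\<in>E. (x i)\<^sup>2) + (\<Sum>i\<in>D. (y i)\<^sup>2)"
      using fin(3) by (intro arg_cong2[where f="(+)"] sum.cong) (auto simp: merge_def)
    finally show "(\<Sum>i\<in>E. (x i)\<^sup>2) + (\<Sum>i\<in>D. (y i)\<^sup>2) = (\<Sum>i\<in>Basis. (merge E D (x, y) i)\<^sup>2)" ..
  qed
  also have "\<dots> = (\<integral>\<^sup>+f. ennreal (sigma_cube (card D)) * indicator {..r\<^sup>2} (\<Sum>i\<in>Basis. (f i)\<^sup>2) \<partial>Pi\<^sub>M (E \<union> D) (\<lambda>_. lborel))"
    using fin(1-3) by (intro product_nn_integral_fold[symmetric]) (auto simp: fin(4))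
  also have "\<dots> = ennreal (sigma_cube (card D)) * (\<integral>\<^sup>+f. indicator {..r\<^sup>2} (\<Sum>i\<in>Basis. (f i)\<^sup>2) \<partial>Pi\<^sub>M (Basis::'a set) (\<lambda>_. lborel))"
    unfolding fin(4) by (intro nn_integral_cmult) measurable
  also have "(\<integral>\<^sup>+f. indicator {..r\<^sup>2} (\<Sum>i\<in>Basis. (f i)\<^sup>2) \<partial>Pi\<^sub>M (Basis::'a set) (\<lambda>_. lborel)) =
      (\<integral>\<^sup>+f. indicator ({f. sqrt (\<Sum>i\<in>Basis. (f i)\<^sup>2) \<le> r} \<inter> space (Pi\<^sub>M Basis (\<lambda>_. lborel))) f \<partial>Pi\<^sub>M (Basis::'a set) (\<lambda>_. lborel))"
  proof (intro nn_integral_cong)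
    fix f :: "'a \<Rightarrow> real" assume "f \<in> space (Pi\<^sub>M Basis (\<lambda>_. lborel))"
    moreover have "sqrt (\<Sum>i\<in>Basis. (f i)\<^sup>2) \<le> r \<longleftrightarrow> (\<Sum>i\<in>Basis. (f i)\<^sup>2) \<le> r\<^sup>2"
      using real_sqrt_le_iff[of "\<Sum>i\<in>Basis. (f i)\<^sup>2" "r\<^sup>2"] r by simp
    ultimately show "indicator {..r\<^sup>2} (\<Sum>i\<in>Basis. (f i)\<^sup>2) =
        (indicator ({f. sqrt (\<Sum>i\<in>Basis. (f i)\<^sup>2) \<le> r} \<inter> space (Pi\<^sub>M Basis (\<lambda>_. lborel))) f :: ennreal)"
      by (simp add: indicator_def)
  qed
  also have "\<dots> = emeasure (Pi\<^sub>M Basis (\<lambda>_. lborel)) ({f. sqrt (\<Sum>i\<in>Basis. (f i)\<^sup>2) \<le> r} \<inter> space (Pi\<^sub>M (Basis::'a set) (\<lambda>_. lborel)))"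
  proof (rule nn_integral_indicator)
    have "{f \<in> space (Pi\<^sub>M Basis (\<lambda>_. lborel)). sqrt (\<Sum>i\<in>Basis. (f i)\<^sup>2) \<le> r} \<in> sets (Pi\<^sub>M (Basis::'a set) (\<lambda>_. lborel))"
      by measurable
    then show "{f. sqrt (\<Sum>i\<in>Basis. (f i)\<^sup>2) \<le> r} \<inter> space (Pi\<^sub>M Basis (\<lambda>_. lborel)) \<in> sets (Pi\<^sub>M (Basis::'a set) (\<lambda>_. lborel))"
      by (simp add: Int_def conj_commute)
  qed
  also have "\<dots> = emeasure lborel (cball (0::'a) r)"
    using r by (simp add: emeasure_cball_aux emeasure_cball)
  finally show ?thesis unfolding E_def .
qed

text \<open>Translation by \<open>c\<close> moves the cube to the corner \<open>a - c\<close>, which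
  the centred version allows since its corner is arbitrary.\<close>

lemma nn_integral_chord:
  fixes a c :: "'a::euclidean_space"
  assumes D: "D \<subseteq> Basis" "D \<noteq> {}" and r: "0 < r"
  shows "(\<integral>\<^sup>+u. ennreal ((2 * sqrt (max 0 (r\<^sup>2 - (\<Sum>i\<in>Basis - D. ((u - c) \<bullet> i)\<^sup>2)))) ^ card D)
              * indicator (cbox a (a + One)) u \<partial>lborel)
         \<le> ennreal (sigma_cube (card D)) * emeasure lborel (cball c r)"
    (is "?L \<le> _")
proof -
  have eq: "lborel = distr lborel borel (\<lambda>x. c + x)"
    using lborel_affine[of 1 c] by (simp add: density_1)
  have "?L = (\<integral>\<^sup>+u. ennreal ((2 * sqrt (max 0 (r\<^sup>2 - (\<Sum>i\<in>Basis - D. (u \<bullet> i)\<^sup>2)))) ^ card D)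
              * indicator (cbox (a - c) (a - c + One)) u \<partial>lborel)"
    by (subst eq, subst nn_integral_distr)
      (auto intro!: nn_integral_cong arg_cong2[where f="(*)"] simp: indicator_def mem_box inner_add_left inner_diff_left algebra_simps)
  also have "\<dots> \<le> ennreal (sigma_cube (card D)) * emeasure lborel (cball (0::'a) r)"
    by (rule nn_integral_chord_centered[OF assms])
  also have "emeasure lborel (cball (0::'a) r) = emeasure lborel (cball c r)"
    using r by (simp add: emeasure_cball)
  finally show ?thesis .
qed

section \<open>Hausdorff measure of coordinate boxes\<close>

lemma hausdorff_pre_le_countable_cover:
  assumes J: "countable J" and S: "S \<subseteq> (\<Union>j\<in>J. U j)" and "0 \<le> \<delta>"
    and U: "\<And>j. j \<in> J \<Longrightarrow> bounded (U j) \<and> diameter (U j) \<le> \<delta>"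
  shows "hausdorff_pre s \<delta> S \<le> (\<integral>\<^sup>+j. ennreal (diameter (U j) powr s) \<partial>count_space J)"
proof -
  define I where "I = to_nat_on J ` J"
  define V where "V n = (if n \<in> I then U (from_nat_into J n) else {})" for n
  have inj: "inj_on (to_nat_on J) J" using J by (rule inj_on_to_nat_on)
  have V: "V (to_nat_on J j) = U j" if "j \<in> J" for j
    using that J by (simp add: V_def I_def)
  have "hausdorff_pre s \<delta> S \<le> (\<Sum>n. ennreal (diameter (V n) powr s))"
    unfolding hausdorff_pre_def
  proof (rule Inf_lower, intro CollectI exI conjI allI)
    show "S \<subseteq> (\<Union>n. V n)"
    proof
      fix x assume "x \<in> S"
      then obtain j where "j \<in> J" "x \<in> U j" using S by auto
      then show "x \<in> (\<Union>n. V n)" using V by auto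
    qed
    show "bounded (V n)" "diameter (V n) \<le> \<delta>" for n
      using U V \<open>0 \<le> \<delta>\<close> by (cases "n \<in> I"; auto simp: V_def I_def J)+
  qed simp
  also have "\<dots> = (\<integral>\<^sup>+n. ennreal (diameter (V n) powr s) \<partial>count_space UNIV)"
    by (rule nn_integral_count_space_nat[symmetric])
  also have "\<dots> = (\<integral>\<^sup>+n. ennreal (diameter (V n) powr s) * indicator I n \<partial>count_space UNIV)"
    by (intro nn_integral_cong) (auto simp: V_def indicator_def)
  also have "\<dots> = (\<integral>\<^sup>+n. ennreal (diameter (V n) powr s) \<partial>count_space I)"
    by (simp add: nn_integral_count_space_indicator)
  also have "\<dots> = (\<integral>\<^sup>+j. ennreal (diameter (V (to_nat_on J j)) powr s) \<partial>count_space J)"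
    unfolding I_def
    by (rule nn_integral_bij_count_space[symmetric]) (rule inj_on_imp_bij_betw[OF inj])
  also have "\<dots> = (\<integral>\<^sup>+j. ennreal (diameter (U j) powr s) \<partial>count_space J)"
    by (intro nn_integral_cong) (simp add: V)
  finally show ?thesis .
qed

text \<open>Two covers, each within \<open>e / 2\<close> of optimal, are merged into one cover
  indexed by \<open>bool \<times> nat\<close>.\<close>

lemma hausdorff_pre_Un_le:
  assumes "0 \<le> \<delta>"
  shows "hausdorff_pre s \<delta> (S \<union> T) \<le> hausdorff_pre s \<delta> S + hausdorff_pre s \<delta> T"
proof (rule ennreal_le_epsilon)
  fix e :: real
  assume fin: "hausdorff_pre s \<delta> S + hausdorff_pre s \<delta> T < top" and "0 < e"
  have ex: "\<exists>U. R \<subseteq> (\<Union>i. U i) \<and> (\<forall>i. bounded (U i) \<and> diameter (U i) \<le> \<delta>) \<and>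
      (\<Sum>i. ennreal (diameter (U i) powr s)) < hausdorff_pre s \<delta> R + ennreal (e / 2)"
    if "hausdorff_pre s \<delta> R < top" for R
  proof -
    \<comment> \<open>Strictness needs a finite value; \<open>ennreal_le_epsilon\<close> lets
      finiteness of the right-hand side be assumed.\<close>
    have "hausdorff_pre s \<delta> R < hausdorff_pre s \<delta> R + ennreal (e / 2)"
      using that \<open>0 < e\<close>
      by (cases "hausdorff_pre s \<delta> R" rule: ennreal_cases) (auto simp: ennreal_less_iff simp flip: ennreal_plus)
    then show ?thesis
      unfolding hausdorff_pre_def[of s \<delta> R] Inf_less_iff by blast
  qed
  have finS: "hausdorff_pre s \<delta> S < top" and finT: "hausdorff_pre s \<delta> T < top"
    using fin by (auto simp: less_top)
  obtain U where U: "S \<subseteq> (\<Union>i. U i)" "\<And>i. bounded (U i) \<and> diameter (U i) \<le> \<delta>"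
      "(\<Sum>i. ennreal (diameter (U i) powr s)) < hausdorff_pre s \<delta> S + ennreal (e / 2)"
    using ex[OF finS] by blast
  obtain V where V: "T \<subseteq> (\<Union>i. V i)" "\<And>i. bounded (V i) \<and> diameter (V i) \<le> \<delta>"
      "(\<Sum>i. ennreal (diameter (V i) powr s)) < hausdorff_pre s \<delta> T + ennreal (e / 2)"
    using ex[OF finT] by blast
  define f where "f = (\<lambda>(b, n). ennreal (diameter (if b then U n else V n) powr s))"
  have "hausdorff_pre s \<delta> (S \<union> T) \<le> (\<integral>\<^sup>+z. ennreal (diameter (case z of (b, n) \<Rightarrow> if b then U n else V n) powr s)
      \<partial>count_space (UNIV :: (bool \<times> nat) set))"
  proof (rule hausdorff_pre_le_countable_cover)
    show "S \<union> T \<subseteq> (\<Union>z\<in>UNIV. case z of (b, n) \<Rightarrow> if b then U n else V n)"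
    proof
      fix x assume "x \<in> S \<union> T"
      then obtain n where "x \<in> (if True then U n else V n) \<or> x \<in> (if False then U n else V n)"
        using U(1) V(1) by auto
      then show "x \<in> (\<Union>z\<in>UNIV. case z of (b, n) \<Rightarrow> if b then U n else V n)" by blast
    qed
  qed (use U(2) V(2) assms in \<open>simp_all split: prod.split\<close>)
  also have "\<dots> = (\<integral>\<^sup>+b. \<integral>\<^sup>+n. f (b, n) \<partial>count_space UNIV \<partial>count_space UNIV)"
    unfolding nn_integral_fst_count_space by (simp add: f_def case_prod_beta')
  also have "\<dots> = (\<integral>\<^sup>+n. f (True, n) \<partial>count_space UNIV) + (\<integral>\<^sup>+n. f (False, n) \<partial>count_space UNIV)"
    by (subst nn_integral_count_space_finite) (simp_all add: UNIV_bool add.commute)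
  also have "\<dots> = (\<Sum>i. ennreal (diameter (U i) powr s)) + (\<Sum>i. ennreal (diameter (V i) powr s))"
    unfolding nn_integral_count_space_nat f_def by simp
  also have "\<dots> \<le> (hausdorff_pre s \<delta> S + ennreal (e / 2)) + (hausdorff_pre s \<delta> T + ennreal (e / 2))"
    using U(3) V(3) by (intro add_mono) auto
  also have "\<dots> = hausdorff_pre s \<delta> S + hausdorff_pre s \<delta> T + (ennreal (e / 2) + ennreal (e / 2))"
    by (simp add: ac_simps)
  also have "ennreal (e / 2) + ennreal (e / 2) = ennreal e"
    using \<open>0 < e\<close> by (simp flip: ennreal_plus)
  finally show "hausdorff_pre s \<delta> (S \<union> T) \<le> hausdorff_pre s \<delta> S + hausdorff_pre s \<delta> T + ennreal e" .
qed

lemma hausdorff_measure_mono: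
  assumes "S \<subseteq> T"
  shows "hausdorff_measure s S \<le> hausdorff_measure s T"
  unfolding hausdorff_measure_eq_SUP
proof (rule SUP_mono)
  fix \<delta> :: real assume "\<delta> \<in> {0<..}"
  moreover have "hausdorff_pre s \<delta> S \<le> hausdorff_pre s \<delta> T"
    unfolding hausdorff_pre_def by (rule Inf_superset_mono) (use assms in blast)
  ultimately show "\<exists>\<epsilon>\<in>{0<..}. hausdorff_pre s \<delta> S \<le> hausdorff_pre s \<epsilon> T" by blast
qed

lemma hausdorff_measure_empty: "hausdorff_measure s ({}::'a::metric_space set) = 0"
proof -
  have "hausdorff_pre s \<delta> ({}::'a set) \<le> 0" if "0 < \<delta>" for \<delta>
    using hausdorff_pre_le_countable_cover[of "{}" "{}::'a set" undefined \<delta> s] that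
    by (simp add: nn_integral_count_space_finite)
  then have "(SUP \<delta>\<in>{0<..}. hausdorff_pre s \<delta> ({}::'a set)) \<le> 0"
    by (intro SUP_least) simp
  then show ?thesis by (simp add: hausdorff_measure_eq_SUP)
qed

lemma hausdorff_measure_Un_le:
  "hausdorff_measure s (S \<union> T) \<le> hausdorff_measure s S + hausdorff_measure s T"
  unfolding hausdorff_measure_eq_SUP[of s "S \<union> T"]
proof (rule SUP_least)
  fix \<delta> :: real assume \<delta>: "\<delta> \<in> {0<..}"
  then have "hausdorff_pre s \<delta> (S \<union> T) \<le> hausdorff_pre s \<delta> S + hausdorff_pre s \<delta> T"
    by (intro hausdorff_pre_Un_le) simp
  also have "\<dots> \<le> hausdorff_measure s S + hausdorff_measure s T"
    unfolding hausdorff_measure_eq_SUP using \<delta> by (intro add_mono SUP_upper)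
  finally show "hausdorff_pre s \<delta> (S \<union> T) \<le> hausdorff_measure s S + hausdorff_measure s T" .
qed

lemma hausdorff_measure_UN_le:
  assumes "finite I"
  shows "hausdorff_measure s (\<Union>i\<in>I. S i) \<le> (\<Sum>i\<in>I. hausdorff_measure s (S i))"
  using assms
proof (induction I rule: finite_induct)
  case (insert i I)
  then have "hausdorff_measure s (S i \<union> (\<Union>i\<in>I. S i)) \<le> hausdorff_measure s (S i) + (\<Sum>i\<in>I. hausdorff_measure s (S i))"
    by (meson add_left_mono hausdorff_measure_Un_le order_trans)
  then show ?case using insert by simp
qed (simp add: hausdorff_measure_empty)

text \<open>Degenerate boxes are allowed: they show that lower-dimensional boxes are null.\<close>

lemma hausdorff_measure_coordinate_box_le:
  fixes a b :: "'a::euclidean_space"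
  assumes D: "D \<subseteq> Basis" "D \<noteq> {}" and ab: "\<And>i. i \<in> D \<Longrightarrow> a \<bullet> i \<le> b \<bullet> i"
  shows "hausdorff_measure (real (card D))
           {x. (\<forall>i\<in>D. a \<bullet> i \<le> x \<bullet> i \<and> x \<bullet> i \<le> b \<bullet> i) \<and> (\<forall>i\<in>Basis - D. x \<bullet> i = a \<bullet> i)}
         \<le> ennreal (sigma_cube (card D) * (\<Prod>i\<in>D. (b - a) \<bullet> i))"
    (is "hausdorff_measure _ ?Q \<le> ?R")
  unfolding hausdorff_measure_eq_SUP
proof (rule SUP_least, rule ennreal_le_epsilon)
  fix \<delta> e :: real
  assume "\<delta> \<in> {0<..}" and e: "0 < e"
  then have \<delta>: "0 < \<delta>" by simp
  define d where "d = card D"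
  define E where "E = Basis - D"
  have fin: "finite D" "finite E" "E \<inter> D = {}" "D \<inter> E = {}" "Basis = D \<union> E"
    using D finite_subset[OF D(1)] by (auto simp: E_def)
  have d: "0 < d" using D fin by (simp add: d_def card_gt_0_iff)
  \<comment> \<open>\<open>mix x y\<close> takes its \<open>D\<close>-coordinates from
    \<open>x\<close> and the others from \<open>y\<close>. Thus
    \<open>cbox a (mix b (a + One))\<close> is \<open>?Q\<close> thickened by length 1 in every
    direction of \<open>E\<close>, so its ambient volume is still \<open>P\<close>.\<close>
  define mix where "mix x y = (\<Sum>i\<in>D. (x \<bullet> i) *\<^sub>R i) + (\<Sum>i\<in>E. (y \<bullet> i) *\<^sub>R i)" for x y :: 'a
  have mix_D: "mix x y \<bullet> i = x \<bullet> i" if "i \<in> D" for x y i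
  proof -
    have "mix x y \<bullet> i = (\<Sum>j\<in>D. if j = i then x \<bullet> i else 0) + (\<Sum>j\<in>E. 0)"
      unfolding mix_def inner_add_left inner_sum_left
      using that D(1) by (intro arg_cong2[where f="(+)"] sum.cong) (auto simp: inner_Basis subset_iff E_def)
    then show ?thesis using that fin by (simp add: sum.delta')
  qed
  have mix_E: "mix x y \<bullet> i = y \<bullet> i" if "i \<in> E" for x y i
  proof -
    have "mix x y \<bullet> i = (\<Sum>j\<in>D. 0) + (\<Sum>j\<in>E. if j = i then y \<bullet> i else 0)"
      unfolding mix_def inner_add_left inner_sum_left
      using that D(1) by (intro arg_cong2[where f="(+)"] sum.cong) (auto simp: inner_Basis subset_iff E_def)
    then show ?thesis using that fin by (simp add: sum.delta')
  qed
  have norm2: "(norm z)\<^sup>2 = (\<Sum>i\<in>D. (z \<bullet> i)\<^sup>2) + (\<Sum>i\<in>E. (z \<bullet> i)\<^sup>2)" for z :: 'a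
  proof -
    have "(norm z)\<^sup>2 = (\<Sum>i\<in>D \<union> E. (z \<bullet> i)\<^sup>2)"
      unfolding power2_norm_eq_inner euclidean_inner[of z z] fin(5) by (simp add: power2_eq_square)
    also have "\<dots> = (\<Sum>i\<in>D. (z \<bullet> i)\<^sup>2) + (\<Sum>i\<in>E. (z \<bullet> i)\<^sup>2)"
      using fin(1,2,4) by (rule sum.union_disjoint)
    finally show ?thesis .
  qed
  define P where "P = (\<Prod>i\<in>D. (b - a) \<bullet> i)"
  define \<sigma> where "\<sigma> = sigma_cube d"
  have \<sigma>: "\<sigma> > 0" by (simp add: \<sigma>_def sigma_cube_pos)
  have P: "P \<ge> 0" unfolding P_def using ab by (intro prod_nonneg) (auto simp: inner_diff_left)
  have vol: "emeasure lborel (cbox a (mix b (a + One))) = ennreal P"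
  proof -
    have "a \<bullet> i \<le> mix b (a + One) \<bullet> i" if "i \<in> Basis" for i
      using that ab[of i] by (cases "i \<in> D") (simp_all add: mix_D mix_E inner_add_left E_def)
    then have "emeasure lborel (cbox a (mix b (a + One))) = (\<Prod>i\<in>D \<union> E. (mix b (a + One) - a) \<bullet> i)"
      unfolding fin(5)[symmetric] by (rule emeasure_lborel_cbox)
    also have "(\<Prod>i\<in>D \<union> E. (mix b (a + One) - a) \<bullet> i) =
        (\<Prod>i\<in>D. (mix b (a + One) - a) \<bullet> i) * (\<Prod>i\<in>E. (mix b (a + One) - a) \<bullet> i)"
      using fin(1,2,4) by (rule prod.union_disjoint)
    also have "(\<Prod>i\<in>D. (mix b (a + One) - a) \<bullet> i) = P"
      unfolding P_def by (intro prod.cong) (auto simp: mix_D inner_diff_left)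
    also have "(\<Prod>i\<in>E. (mix b (a + One) - a) \<bullet> i) = 1"
      by (intro prod.neutral) (auto simp: mix_E inner_diff_left inner_add_left E_def)
    finally show ?thesis by simp
  qed
  have unit: "emeasure lborel (cbox a (a + One)) = 1"
    by (subst emeasure_lborel_cbox) (auto simp: inner_add_left)
  \<comment> \<open>Passing from ball volumes to slices multiplies by \<open>\<sigma>\<close>, so
    the excess \<open>e / (2 * \<sigma>)\<close> becomes \<open>e / 2\<close>, strictly below the
    allowed \<open>e\<close>.\<close>
  have pos: "0 < \<delta> / 2" "0 < e / (2 * \<sigma>)" using \<delta> e \<sigma> by simp_all
  obtain C where C: "countable C" "\<And>c r. (c, r) \<in> C \<Longrightarrow> 0 < r \<and> r \<le> \<delta> / 2"
    "cbox a (mix b (a + One)) \<subseteq> (\<Union>(c, r)\<in>C. cball c r)"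
    "(\<integral>\<^sup>+(c, r). emeasure lborel (cball c r) \<partial>count_space C)
      \<le> emeasure lborel (cbox a (mix b (a + One))) + ennreal (e / (2 * \<sigma>))"
    by (rule cbox_cover_by_small_cballs[OF pos, of a "mix b (a + One)"]) (assumption | rule that)+
  \<comment> \<open>\<open>\<rho> z u\<close> is the radius of the slice of the ball
    \<open>z\<close> by the plane through \<open>u\<close> in the directions \<open>D\<close>. It
    depends only on the \<open>E\<close>-coordinates of \<open>u\<close>, but letting
    \<open>u\<close> range over a full unit cube keeps the averaging in
    \<open>lborel\<close>.\<close>
  define \<rho> where "\<rho> = (\<lambda>(c, r) u. sqrt (max 0 (r\<^sup>2 - (\<Sum>i\<in>E. ((u - c) \<bullet> i)\<^sup>2))))"
  have \<rho>_nonneg: "0 \<le> \<rho> z u" for z u by (simp add: \<rho>_def split_beta)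
  define F where "F u = (\<integral>\<^sup>+z. ennreal ((2 * \<rho> z u) ^ d) \<partial>count_space C)" for u
  \<comment> \<open>The average of \<open>F\<close> over the unit cube is at most
    \<open>\<sigma> * P + e / 2\<close>: exchange sum and integral, then apply
    \<open>nn_integral_chord\<close> to each ball. Hence some \<open>u\<close> lies below
    \<open>\<sigma> * P + e\<close>.\<close>
  have "\<exists>u\<in>cbox a (a + One). F u < ennreal (\<sigma> * P + e)"
  proof (rule ccontr)
    assume "\<not> ?thesis"
    then have "(\<integral>\<^sup>+u. ennreal (\<sigma> * P + e) * indicator (cbox a (a + One)) u \<partial>lborel)
        \<le> (\<integral>\<^sup>+u. F u * indicator (cbox a (a + One)) u \<partial>lborel)"
      by (intro nn_integral_mono) (auto simp: indicator_def not_less)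
    also have "\<dots> = (\<integral>\<^sup>+u. (\<integral>\<^sup>+z. ennreal ((2 * \<rho> z u) ^ d) * indicator (cbox a (a + One)) u \<partial>count_space C) \<partial>lborel)"
      unfolding F_def by (intro nn_integral_cong nn_integral_multc[symmetric]) simp
    also have "\<dots> = (\<integral>\<^sup>+z. (\<integral>\<^sup>+u. ennreal ((2 * \<rho> z u) ^ d) * indicator (cbox a (a + One)) u \<partial>lborel) \<partial>count_space C)"
      using C(1) by (intro nn_integral_count_space_nn_integral) (auto simp: \<rho>_def split_beta)
    also have "\<dots> \<le> (\<integral>\<^sup>+z. ennreal \<sigma> * (case z of (c, r) \<Rightarrow> emeasure lborel (cball c r)) \<partial>count_space C)"
    proof (intro nn_integral_mono)
      fix z assume "z \<in> space (count_space C)"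
      then show "(\<integral>\<^sup>+u. ennreal ((2 * \<rho> z u) ^ d) * indicator (cbox a (a + One)) u \<partial>lborel)
          \<le> ennreal \<sigma> * (case z of (c, r) \<Rightarrow> emeasure lborel (cball c r))"
        using nn_integral_chord[OF D, of "snd z" "fst z" a] C(2)[of "fst z" "snd z"]
        by (simp add: \<rho>_def split_beta d_def \<sigma>_def E_def)
    qed
    also have "\<dots> = ennreal \<sigma> * (\<integral>\<^sup>+(c, r). emeasure lborel (cball c r) \<partial>count_space C)"
      by (intro nn_integral_cmult) simp
    also have "\<dots> \<le> ennreal \<sigma> * (ennreal P + ennreal (e / (2 * \<sigma>)))"
      using C(4) unfolding vol by (intro mult_left_mono) auto
    also have "\<dots> = ennreal (\<sigma> * P + e / 2)"
      using \<sigma> P e by (simp add: ennreal_mult'[symmetric] distrib_left flip: ennreal_plus)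
    finally have "ennreal (\<sigma> * P + e) \<le> ennreal (\<sigma> * P + e / 2)"
      by (simp add: nn_integral_cmult_indicator unit)
    then show False using \<sigma> P e by (simp add: ennreal_le_iff)
  qed
  then obtain u where u: "u \<in> cbox a (a + One)" "F u < ennreal (\<sigma> * P + e)" by blast
  \<comment> \<open>\<open>U z\<close> is the slice of the ball \<open>z\<close> by the plane
    through \<open>u\<close>, translated along the directions \<open>E\<close> into the plane of
    \<open>?Q\<close>.\<close>
  define U where "U = (\<lambda>(c, r). {x. (\<forall>i\<in>E. x \<bullet> i = a \<bullet> i) \<and>
      (\<Sum>i\<in>D. ((x - c) \<bullet> i)\<^sup>2) + (\<Sum>i\<in>E. ((u - c) \<bullet> i)\<^sup>2) \<le> r\<^sup>2})"
  have U_sub: "U z \<subseteq> cball (mix (fst z) a) (\<rho> z u)" for z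
  proof
    fix x assume x: "x \<in> U z"
    have "(norm (x - mix (fst z) a))\<^sup>2 = (\<Sum>i\<in>D. ((x - fst z) \<bullet> i)\<^sup>2) + (\<Sum>i\<in>E. 0)"
      unfolding norm2 using x
      by (intro arg_cong2[where f="(+)"] sum.cong) (auto simp: U_def inner_diff_left mix_D mix_E)
    also have "\<dots> \<le> max 0 ((snd z)\<^sup>2 - (\<Sum>i\<in>E. ((u - fst z) \<bullet> i)\<^sup>2))"
      using x by (auto simp: U_def split_beta)
    finally have "norm (x - mix (fst z) a) \<le> \<rho> z u"
      unfolding \<rho>_def split_beta by (rule real_le_rsqrt)
    then show "x \<in> cball (mix (fst z) a) (\<rho> z u)"
      by (simp add: dist_norm norm_minus_commute)
  qed
  have diam: "diameter (U z) \<le> 2 * \<rho> z u" for z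
    using diameter_subset[OF U_sub[of z]] \<rho>_nonneg[of z u] by simp
  have "hausdorff_pre (real d) \<delta> ?Q \<le> (\<integral>\<^sup>+z. ennreal (diameter (U z) powr real d) \<partial>count_space C)"
  proof (rule hausdorff_pre_le_countable_cover)
    show "?Q \<subseteq> (\<Union>z\<in>C. U z)"
    proof
      fix x assume x: "x \<in> ?Q"
      \<comment> \<open>Shifting \<open>x\<close> into the plane through \<open>u\<close> lands in
        the thickened box, hence in some ball of \<open>C\<close>; shifting back puts
        \<open>x\<close> in the corresponding \<open>U z\<close>.\<close>
      have "mix x u \<in> cbox a (mix b (a + One))"
        unfolding mem_box
      proof
        fix i :: 'a assume "i \<in> Basis"
        then show "a \<bullet> i \<le> mix x u \<bullet> i \<and> mix x u \<bullet> i \<le> mix b (a + One) \<bullet> i"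
          using x u(1) by (cases "i \<in> D") (simp_all add: mem_box mix_D mix_E inner_add_left E_def)
      qed
      then obtain c r where cr: "(c, r) \<in> C" "mix x u \<in> cball c r" using C(3) by auto
      have "(norm (mix x u - c))\<^sup>2 \<le> r\<^sup>2"
        using cr C(2)[OF cr(1)] by (intro power_mono) (auto simp: dist_norm norm_minus_commute)
      then have "x \<in> U (c, r)"
        using x unfolding norm2 by (simp add: U_def E_def[symmetric] inner_diff_left mix_D mix_E)
      then show "x \<in> (\<Union>z\<in>C. U z)" using cr by blast
    qed
    fix z assume z: "z \<in> C"
    have "\<rho> z u \<le> sqrt ((snd z)\<^sup>2)"
      unfolding \<rho>_def split_beta by (intro real_sqrt_le_mono) (simp add: sum_nonneg)
    then have "\<rho> z u \<le> \<delta> / 2" using C(2)[of "fst z" "snd z"] z by simp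
    then show "bounded (U z) \<and> diameter (U z) \<le> \<delta>"
      using diam[of z] bounded_subset[OF bounded_cball U_sub[of z]] by simp
  qed (use C \<delta> in auto)
  also have "\<dots> \<le> F u"
    unfolding F_def
  proof (intro nn_integral_mono ennreal_leI)
    fix z
    have "diameter (U z) powr real d \<le> (2 * \<rho> z u) powr real d"
      using diam[of z] diameter_ge_0[OF bounded_subset[OF bounded_cball U_sub[of z]]]
      by (intro powr_mono2) auto
    \<comment> \<open>When the radius is 0, the two kinds of power agree only because
      \<open>d\<close> is positive.\<close>
    then show "diameter (U z) powr real d \<le> (2 * \<rho> z u) ^ d"
      using d \<rho>_nonneg[of z u] by (simp add: powr_realpow')
  qed
  also have "\<dots> \<le> ennreal (\<sigma> * P) + ennreal e"
    using u(2) \<sigma> P e by (simp flip: ennreal_plus)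
  finally show "hausdorff_pre (real (card D)) \<delta> ?Q \<le> ?R + ennreal e"
    by (simp add: d_def \<sigma>_def P_def)
qed

section \<open>Intersecting families of vectors\<close>

lemma hausdorff_measure_coordinate_box_cart_le:
  fixes a b :: "real ^ 'n"
  assumes "D \<noteq> {}" and ab: "\<And>i. i \<in> D \<Longrightarrow> a $ i \<le> b $ i"
  shows "hausdorff_measure (real (card D))
           {x. (\<forall>i\<in>D. a $ i \<le> x $ i \<and> x $ i \<le> b $ i) \<and> (\<forall>i\<in>-D. x $ i = a $ i)}
         \<le> ennreal (sigma_cube (card D) * (\<Prod>i\<in>D. b $ i - a $ i))"
proof -
  let ?ax = "\<lambda>i::'n. axis i (1::real)"
  have inj: "inj ?ax" by (auto simp: inj_def axis_eq_axis)
  have Basis: "Basis - ?ax ` D = ?ax ` (- D)"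
    using inj by (auto simp: Basis_vec_def inj_def)
  have "hausdorff_measure (real (card (?ax ` D)))
           {x. (\<forall>i\<in>?ax ` D. a \<bullet> i \<le> x \<bullet> i \<and> x \<bullet> i \<le> b \<bullet> i) \<and> (\<forall>i\<in>Basis - ?ax ` D. x \<bullet> i = a \<bullet> i)}
         \<le> ennreal (sigma_cube (card (?ax ` D)) * (\<Prod>i\<in>?ax ` D. (b - a) \<bullet> i))"
    using assms by (intro hausdorff_measure_coordinate_box_le) (auto simp: Basis_vec_def inner_axis)
  then show ?thesis
    unfolding Basis using inj
    by (simp add: card_image inj_on_subset prod.reindex inner_axis inner_diff_left)
qed

theorem theorem1p10:
  fixes A :: "(real ^ 'n) set" and n k t :: nat
  assumes "n = CARD('n)"
    and "0 < t" and "t < k" and "k \<le> n"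
    and "nkt_set k t A"
  shows "hausdorff_measure (real (k - t)) A
           \<le> ennreal (real ((n - t) choose (k - t)) * sigma_cube (k - t))"
proof -
  define d where "d = k - t"
  define box where "box a b D = {x :: real ^ 'n. (\<forall>i\<in>D. a $ i \<le> x $ i \<and> x $ i \<le> b $ i) \<and> (\<forall>i\<in>-D. x $ i = a $ i)}"
    for a b :: "real ^ 'n" and D
  define supp where "supp x = {i. x $ i > 0}" for x :: "real ^ 'n"
  have d: "0 < d" using assms by (simp add: d_def)
  have box_le: "hausdorff_measure (real d) (box a b D) \<le> ennreal (sigma_cube d * (\<Prod>i\<in>D. b $ i - a $ i))"
    if "card D = d" "\<And>i. i \<in> D \<Longrightarrow> a $ i \<le> b $ i" for a b D
  proof -
    have "D \<noteq> {}" using that(1) d by auto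
    then show ?thesis
      using hausdorff_measure_coordinate_box_cart_le[of D a b] that by (simp add: box_def)
  qed
  have unit: "0 \<le> x $ i" "x $ i \<le> 1" and supp: "card (supp x) = k" if "x \<in> A" for x i
    using assms(5) that by (auto simp: nkt_set_def supp_def)
  have agree: "\<exists>I. card I = t \<and> (\<forall>i\<in>I. x $ i = y $ i \<and> y $ i > 0)" if "x \<in> A" "y \<in> A" for x y
    using assms(5) that by (auto simp: nkt_set_def)
  have card_free: "card (supp x - I) = d" if "x \<in> A" "card I = t" "I \<subseteq> supp x" for x I
    using that supp by (simp add: card_Diff_subset d_def)
  have off_supp: "x $ i = 0" if "x \<in> A" "i \<notin> supp x" for x i
    using that unit(1)[of x i] by (simp add: supp_def)
  \<comment> \<open>If no \<open>t\<close>-set works in the case \<open>star\<close> for any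
    \<open>p\<close>, then in particular none works for a chosen \<open>p \<in> A\<close>, which is
    the case \<open>spread\<close>.\<close>
  consider (empty) "A = {}"
    | (star) I p where "card I = t" "\<And>x i. x \<in> A \<Longrightarrow> i \<in> I \<Longrightarrow> x $ i = p $ i \<and> x $ i > 0"
    | (spread) p where "p \<in> A" "\<And>I. card I = t \<Longrightarrow> \<exists>z\<in>A. \<exists>i\<in>I. \<not> (z $ i = p $ i \<and> z $ i > 0)"
    by (metis all_not_in_conv)
  then have "hausdorff_measure (real d) A \<le> ennreal (real ((n - t) choose d) * sigma_cube d)"
  proof cases
    case empty
    then show ?thesis by (simp add: hausdorff_measure_empty)
  next
    case (star I p)
    \<comment> \<open>Common corner of all the cubes: frozen to \<open>p\<close> on
      \<open>I\<close>, and 0 elsewhere because points of \<open>A\<close> vanish off their support.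
      The free coordinates of \<open>x\<close> are \<open>supp x - I\<close>.\<close>
    define a :: "real ^ 'n" where "a = (\<chi> i. if i \<in> I then p $ i else 0)"
    define \<D> where "\<D> = {D. D \<subseteq> - I \<and> card D = d}"
    have "A \<subseteq> (\<Union>D\<in>\<D>. box a 1 D)"
    proof
      fix x assume x: "x \<in> A"
      have I: "I \<subseteq> supp x" using star(2)[OF x] by (auto simp: supp_def)
      have "x \<in> box a 1 (supp x - I)"
        using star(2)[OF x] unit[OF x] off_supp[OF x] by (auto simp: box_def a_def)
      moreover have "supp x - I \<in> \<D>"
        using card_free[OF x star(1) I] by (auto simp: \<D>_def)
      ultimately show "x \<in> (\<Union>D\<in>\<D>. box a 1 D)" by blast
    qed
    then have "hausdorff_measure (real d) A \<le> (\<Sum>D\<in>\<D>. hausdorff_measure (real d) (box a 1 D))"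
      by (rule order_trans[OF hausdorff_measure_mono hausdorff_measure_UN_le]) simp
    also have "\<dots> \<le> (\<Sum>D\<in>\<D>. ennreal (sigma_cube d))"
    proof (rule sum_mono)
      fix D assume D: "D \<in> \<D>"
      then have "a $ i = 0" if "i \<in> D" for i using that by (auto simp: a_def \<D>_def)
      then show "hausdorff_measure (real d) (box a 1 D) \<le> ennreal (sigma_cube d)"
        using box_le[of D a 1] D by (simp add: \<D>_def)
    qed
    also have "\<dots> = ennreal (real (card \<D>) * sigma_cube d)"
      using sigma_cube_pos[of d] by (simp add: ennreal_mult' ennreal_of_nat_eq_real_of_nat)
    also have "card \<D> = (n - t) choose d"
      using n_subsets[of "- I" d] star(1) assms(1) by (simp add: \<D>_def Compl_eq_Diff_UNIV card_Diff_subset)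
    finally show ?thesis .
  next
    case (spread p)
    obtain z where z: "\<And>I. card I = t \<Longrightarrow> z I \<in> A \<and> (\<exists>i\<in>I. \<not> (z I $ i = p $ i \<and> z I $ i > 0))"
      using spread(2) by metis
    \<comment> \<open>With \<open>j \<in> D\<close>, the box from \<open>a I j\<close> to
      \<open>b I j\<close> has an edge of length 0 in direction \<open>j\<close>. Keeping
      \<open>j\<close> in \<open>D\<close> makes it a degenerate box with exactly \<open>d\<close>
      directions, so \<open>box_le\<close> applies and gives measure 0.\<close>
    define a :: "'n set \<Rightarrow> 'n \<Rightarrow> real ^ 'n"
      where "a I j = (\<chi> i. if i \<in> I then p $ i else if i = j then z I $ j else 0)" for I j
    define b :: "'n set \<Rightarrow> 'n \<Rightarrow> real ^ 'n"
      where "b I j = (\<chi> i. if i = j then z I $ j else 1)" for I j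
    \<comment> \<open>\<open>I\<close> need not have size \<open>t\<close> here, where
      \<open>z I\<close> is unspecified; such boxes are null all the same and do no harm.\<close>
    define \<N> where "\<N> = {(D, I, j :: 'n). card D = d \<and> D \<inter> I = {} \<and> j \<in> D}"
    have "A \<subseteq> (\<Union>(D, I, j)\<in>\<N>. box (a I j) (b I j) D)"
    proof
      fix x assume x: "x \<in> A"
      obtain I where I: "card I = t" "\<And>i. i \<in> I \<Longrightarrow> x $ i = p $ i \<and> p $ i > 0"
        using agree[OF x spread(1)] by blast
      obtain J where J: "card J = t" "\<And>i. i \<in> J \<Longrightarrow> x $ i = z I $ i \<and> z I $ i > 0"
        using agree[OF x] z[OF I(1)] by blast
      \<comment> \<open>Equal sizes would force \<open>J = I\<close>, and then \<open>z I\<close>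
        would agree with \<open>p\<close> through \<open>x\<close> on all of \<open>I\<close>. So
        \<open>x\<close> is pinned to \<open>z I\<close> at some \<open>j\<close> outside
        \<open>I\<close>.\<close>
      have "\<not> J \<subseteq> I"
      proof
        assume "J \<subseteq> I"
        then have "J = I" using I(1) J(1) by (simp add: card_subset_eq)
        then show False using I(2) J(2) z[OF I(1)] by metis
      qed
      then obtain j where j: "j \<in> J" "j \<notin> I" by blast
      have "I \<subseteq> supp x" using I(2) by (auto simp: supp_def)
      moreover have "j \<in> supp x" using J(2)[OF j(1)] by (simp add: supp_def)
      ultimately have "(supp x - I, I, j) \<in> \<N>"
        using card_free[OF x I(1)] j by (auto simp: \<N>_def)
      moreover have "x \<in> box (a I j) (b I j) (supp x - I)"
        using I(2) J(2)[OF j(1)] \<open>j \<in> supp x\<close> unit[OF x] off_supp[OF x] by (auto simp: box_def a_def b_def)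
      ultimately show "x \<in> (\<Union>(D, I, j)\<in>\<N>. box (a I j) (b I j) D)" by blast
    qed
    then have "hausdorff_measure (real d) A \<le> hausdorff_measure (real d) (\<Union>(D, I, j)\<in>\<N>. box (a I j) (b I j) D)"
      by (rule hausdorff_measure_mono)
    also have "\<dots> \<le> (\<Sum>v\<in>\<N>. hausdorff_measure (real d) (case v of (D, I, j) \<Rightarrow> box (a I j) (b I j) D))"
      by (rule hausdorff_measure_UN_le) simp
    also have "\<dots> \<le> (\<Sum>v\<in>\<N>. 0)"
    proof (rule sum_mono, clarify)
      fix D I j assume "(D, I, j) \<in> \<N>"
      then have D: "card D = d" "D \<inter> I = {}" "j \<in> D" by (auto simp: \<N>_def)
      have "(\<Prod>i\<in>D. b I j $ i - a I j $ i) = 0"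
        using D by (intro prod_zero) (auto simp: a_def b_def intro!: bexI[of _ j])
      moreover have "a I j $ i \<le> b I j $ i" if "i \<in> D" for i
        using that D(2) by (auto simp: a_def b_def)
      ultimately have "hausdorff_measure (real d) (box (a I j) (b I j) D) \<le> ennreal (sigma_cube d * 0)"
        using box_le[OF D(1), of "a I j" "b I j"] by metis
      then show "hausdorff_measure (real d) (box (a I j) (b I j) D) \<le> 0" by simp
    qed
    finally show ?thesis by simp
  qed
  then show ?thesis by (simp add: d_def)
qed

end
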